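(* Let $M$ be a matroid. Then \[ Z_M(q,T) = q^{-\operatorname{rk} M} \sum_{\mathcal{F} \in \mathcal{N}(M)} \frac{\chi_{M_{\mathcal{F}}}(q)}{(q-1)^{\#\mathcal{F}}} \prod_{F \in \mathcal{F} } (q-1) \frac{q^{-\operatorname{rk} F}T^{\#F}}{1 - q^{-\operatorname{rk} F}T^{\#F}}, \] \[ Z_M^0(q,T) = q^{-\operatorname{rk} M} \sum_{\mathcal{F} \in \mathcal{N}^*(M)} \frac{\chi_{M_{\mathcal{F}}}(q)}{(q-1)^{\#\mathcal{F}}} \prod_{F \in \mathcal{F} } (q-1) \frac{q^{-\operatorname{rk} F}T^{\#F}}{1 - q^{-\operatorname{rk} F}T^{\#F}}, \] and \[ \overline{Z}_M(q,T) = q^{-(\operatorname{rk} M-1)} \sum_{\mathcal{F} \in \mathcal{N}^\circ(M)} \frac{\overline{\chi}_{M_{\mathcal{F}}}(q)}{(q-1)^{\#\mathcal{F}}} \prod_{F \in \mathcal{F}} (q-1) \frac{q^{-\operatorname{rk} F}T^{\#F}}{1 - q^{-\operatorname{rk} F}T^{\#F}}. \]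
   Context: Let $M$ be a matroid on finite ground set $E$ with rank function $\operatorname{rk}$ and lattice of flats $\mathcal{L}$; $\chi$ and $\overline{\chi}=\chi/(q-1)$ are the characteristic and reduced characteristic polynomials. For $w\in\mathbb{R}^E$: $\operatorname{wt}_M(w)=\max_{B\text{ basis}}\sum_{e\in B}w_e$, $M_w$ is the matroid on $E$ whose bases are the bases attaining this max, $|w|=\sum_ew_e$. For $v\in\mathbb{R}^E/\mathbb{R}\mathbf{1}$ with lift $w$: $\overline{\operatorname{wt}}_M(v)=\operatorname{wt}_M(w)-(\operatorname{rk}M)\min(w)$, $\overline{|v|}=|w|-(\#E)\min(w)$, $M_v=M_w$. Define $Z_M(q,T)=\sum_{w\in\mathbb{Z}_{\ge0}^E}\chi_{M_w}(q)q^{-\operatorname{rk}M-\operatorname{wt}_M(w)}T^{|w|}$, $Z_M^0$ the same sum over $\mathbb{Z}_{>0}^E$, and $\overline{Z}_M(q,T)=\sum_{v\in\mathbb{Z}^E/\mathbb{Z}\mathbf{1}}\overline{\chi}_{M_v}(q)q^{-(\operatorname{rk}M-1)-\overline{\operatorname{wt}}_M(v)}T^{\overline{|v|}}$. $\mathcal{N}(M)$ is the set of flags of flats strictly containing $\operatorname{cl}(\emptyset)$ (including the empty flag), $\mathcal{N}^*(M)$ the flags containing $E$, $\mathcal{N}^\circ(M)=\mathcal{N}(M)\setminus\mathcal{N}^*(M)$. For a flag $\mathcal{F}$, $M_\mathcal{F}=M_w$ for any $w$ in the relative interior of the cone spanned by indicator vectors $v_F$, $F\in\mathcal{F}$ (well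 defined); $\chi_{M_\mathcal{F}}$ is divisible by $(q-1)^{\#\mathcal{F}}$ and for $\mathcal{F}\in\mathcal{N}^\circ(M)$ so is $\overline{\chi}_{M_\mathcal{F}}$. *)

theory Defs
  imports
    "HOL-Analysis.Analysis"
    "HOL-Computational_Algebra.Computational_Algebra"
begin

text \<open>
  A matroid with ground set the finite type \<open>'e\<close> is given by its set of bases.
  All types are nonempty, so the ground set is a nonempty finite set; this is needed for
  \<open>min(w)\<close> and for the reduced characteristic polynomial to make sense.
\<close>

definition matroid :: "'e::finite set set \<Rightarrow> bool" where
  "matroid M \<longleftrightarrow> M \<noteq> {} \<and>
     (\<forall>A\<in>M. \<forall>B\<in>M. \<forall>a\<in>A - B. \<exists>b\<in>B - A. insert b (A - {a}) \<in> M)"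

definition indep :: "'e::finite set set \<Rightarrow> 'e set \<Rightarrow> bool" where
  "indep M I \<longleftrightarrow> (\<exists>B\<in>M. I \<subseteq> B)"

definition rk :: "'e::finite set set \<Rightarrow> 'e set \<Rightarrow> nat" where
  "rk M A = Max (card ` {I. I \<subseteq> A \<and> indep M I})"

definition cl :: "'e::finite set set \<Rightarrow> 'e set \<Rightarrow> 'e set" where
  "cl M A = {e. rk M (insert e A) = rk M A}"

definition flat :: "'e::finite set set \<Rightarrow> 'e set \<Rightarrow> bool" where
  "flat M F \<longleftrightarrow> cl M F = F"

text \<open>
  The characteristic polynomial in its subset-expansion form, which is the convention valid for
  arbitrary matroids: it agrees with the Moebius-function definition on the lattice of flats
  if the matroid has no loops, and it vanishes if the matroid has a loop.
\<close>

definition charpoly :: "'e::finite set set \<Rightarrow> int poly" where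
  "charpoly M = (\<Sum>A\<in>UNIV. monom ((-1) ^ card A) (rk M UNIV - rk M A))"

text \<open>The division is exact because the ground set is nonempty.\<close>

definition reduced_charpoly :: "'e::finite set set \<Rightarrow> int poly" where
  "reduced_charpoly M = charpoly M div [:-1, 1:]"


text \<open>
  Weights are polymorphic in the coefficients, so as to cover both real and integral vectors.
\<close>

definition wt :: "'e::finite set set \<Rightarrow> 'b::linordered_idom ^ 'e \<Rightarrow> 'b" where
  "wt M w = Max ((\<lambda>B. \<Sum>e\<in>B. w $ e) ` M)"

definition initial :: "'e::finite set set \<Rightarrow> 'b::linordered_idom ^ 'e \<Rightarrow> 'e set set" where
  "initial M w = {B \<in> M. (\<Sum>e\<in>B. w $ e) = wt M w}"

definition coord_sum :: "'b::linordered_idom ^ 'e::finite \<Rightarrow> 'b" where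
  "coord_sum w = (\<Sum>e\<in>UNIV. w $ e)"

definition min_entry :: "'b::linordered_idom ^ 'e::finite \<Rightarrow> 'b" where
  "min_entry w = Min (range (\<lambda>e. w $ e))"

text \<open>
  Vectors modulo the line spanned by the all-ones vector are represented by their cosets.
  The functions below do not depend on the chosen lift when \<open>M\<close> is a matroid.
\<close>

definition ones_rel :: "('b::linordered_idom ^ 'e::finite) rel" where
  "ones_rel = {(w, w'). \<exists>c. w' = w + (\<chi> e. c)}"

definition lift :: "('b::linordered_idom ^ 'e::finite) set \<Rightarrow> 'b ^ 'e" where
  "lift v = (SOME w. w \<in> v)"

definition wt_bar :: "'e::finite set set \<Rightarrow> ('b::linordered_idom ^ 'e) set \<Rightarrow> 'b" where
  "wt_bar M v = wt M (lift v) - of_nat (rk M UNIV) * min_entry (lift v)"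

definition coord_sum_bar :: "('b::linordered_idom ^ 'e::finite) set \<Rightarrow> 'b" where
  "coord_sum_bar v = coord_sum (lift v) - of_nat CARD('e) * min_entry (lift v)"

definition initial_bar :: "'e::finite set set \<Rightarrow> ('b::linordered_idom ^ 'e) set \<Rightarrow> 'e set set" where
  "initial_bar M v = initial M (lift v)"


definition flags :: "'e::finite set set \<Rightarrow> 'e set set set" where
  "flags M = {\<F>. chain\<^sub>\<subseteq> \<F> \<and> (\<forall>F\<in>\<F>. flat M F \<and> cl M {} \<subset> F)}"

definition flags_star :: "'e::finite set set \<Rightarrow> 'e set set set" where
  "flags_star M = {\<F> \<in> flags M. UNIV \<in> \<F>}"

definition flags_circ :: "'e::finite set set \<Rightarrow> 'e set set set" where
  "flags_circ M = flags M - flags_star M"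

definition indicator_vec :: "'e::finite set \<Rightarrow> real ^ 'e" where
  "indicator_vec F = (\<chi> e. indicator F e)"

text \<open>
  For the empty flag the cone is \<open>{0}\<close>, which is its own relative interior.
\<close>

definition flag_matroid :: "'e::finite set set \<Rightarrow> 'e set set \<Rightarrow> 'e set set" where
  "flag_matroid M \<F> =
     (THE N. \<exists>w \<in> rel_interior (convex_cone hull (indicator_vec ` \<F>)). N = initial M w)"


text \<open>
  The zeta functions are power series in \<open>T\<close> over the field of rational functions in \<open>q\<close>, into
  which the Laurent polynomials in \<open>q\<close> embed. The infinite sums are taken in the \<open>T\<close>-adic topology.
\<close>

type_synonym ratfun = "int poly fract"

definition q :: ratfun where
  "q = to_fract [:0, 1:]"

definition zeta_term :: "'e::finite set set \<Rightarrow> int ^ 'e \<Rightarrow> ratfun fps" where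
  "zeta_term M w =
     fps_const (to_fract (charpoly (initial M w)) * q powi (- int (rk M UNIV) - wt M w))
       * fps_X ^ nat (coord_sum w)"

definition zeta :: "'e::finite set set \<Rightarrow> ratfun fps" where
  "zeta M = (\<Sum>\<^sub>\<infinity>w\<in>{w. \<forall>e. w $ e \<ge> 0}. zeta_term M w)"

definition zeta0 :: "'e::finite set set \<Rightarrow> ratfun fps" where
  "zeta0 M = (\<Sum>\<^sub>\<infinity>w\<in>{w. \<forall>e. w $ e > 0}. zeta_term M w)"

definition zeta_bar :: "'e::finite set set \<Rightarrow> ratfun fps" where
  "zeta_bar M =
     (\<Sum>\<^sub>\<infinity>v\<in>(UNIV :: (int ^ 'e) set) // ones_rel.
        fps_const (to_fract (reduced_charpoly (initial_bar M v))
                     * q powi (- (int (rk M UNIV) - 1) - wt_bar M v))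
          * fps_X ^ nat (coord_sum_bar v))"

definition flat_monomial :: "'e::finite set set \<Rightarrow> 'e set \<Rightarrow> ratfun fps" where
  "flat_monomial M F = fps_const (q powi (- int (rk M F))) * fps_X ^ card F"

end

theory Submission
  imports Defs
begin

text \<open>
  A nonnegative integral vector is in a unique way a positive integral combination
  \<open>\<Sum> c\<^sub>F v\<^sub>F\<close> of indicator vectors of a chain of nonempty sets. By the greedy algorithm
  some basis meets every member \<open>F\<close> of the chain in \<open>rk F\<close> elements, so the initial matroid consists
  of the bases with this property and depends on the chain only, and the maximal weight is
  \<open>\<Sum> c\<^sub>F rk F\<close>. If a member of the chain is not a flat, or \<open>M\<close> has a loop, then the initial
  matroid has a loop and its characteristic polynomial vanishes; hence only flags of flats contribute,
  and summing over the coefficients \<open>c\<^sub>F\<close> yields a product of geometric series. The vector is positive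
  iff the whole ground set belongs to its chain, which gives the second formula; a vector modulo the
  all-ones line has a unique lift with minimum 0, which gives the third.
\<close>

section \<open>Bases adapted to a chain of sets\<close>

lemma chain_subset_top_mem:
  assumes "chain\<^sub>\<subseteq> \<C>" "finite \<C>" "\<C> \<noteq> {}"
  shows "\<Union>\<C> \<in> \<C>"
  using Union_in_chain[OF assms(2,3)] assms(1) unfolding chain_subset_alt_def by blast

lemma matroid_exchange:
  assumes "matroid M" "A \<in> M" "B \<in> M" "a \<in> A" "a \<notin> B"
  obtains b where "b \<in> B" "b \<notin> A" "insert b (A - {a}) \<in> M"
  using assms unfolding matroid_def by blast

text \<open>Exchanging an element of \<open>A - B\<close> for one of \<open>B - A\<close> keeps the
  cardinality of \<open>A\<close> and shrinks \<open>A - B\<close>. Once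
  \<open>A \<subseteq> B\<close>, the inclusion cannot be proper: an element of \<open>B - A\<close>
  would have to be exchanged for one of \<open>A - B\<close>, which is empty.\<close>

lemma bases_card_eq:
  assumes M: "matroid M" and "A \<in> M" "B \<in> M"
  shows "card A = card B"
  using assms(2)
proof (induction "card (A - B)" arbitrary: A rule: less_induct)
  case less
  show ?case
  proof (cases "A \<subseteq> B")
    case True
    moreover have "\<not> A \<subset> B"
      using True matroid_exchange[OF M \<open>B \<in> M\<close> less.prems] by blast
    ultimately show ?thesis by auto
  next
    case False
    then obtain a where a: "a \<in> A" "a \<notin> B" by blast
    then obtain b where b: "b \<in> B" "b \<notin> A" "insert b (A - {a}) \<in> M"
      using matroid_exchange[OF M less.prems \<open>B \<in> M\<close>] by blast
    have "card (insert b (A - {a}) - B) < card (A - B)"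
      using a b by (intro psubset_card_mono) auto
    from less.hyps[OF this b(3)] have "card (insert b (A - {a})) = card B" .
    moreover have "card (insert b (A - {a})) = Suc (card (A - {a}))"
      using b by simp
    ultimately show ?thesis
      using card_Suc_Diff1[of A a] a by simp
  qed
qed

text \<open>As long as the basis leaves \<open>I \<union> B\<close>, an element outside can be
  exchanged for one of \<open>B\<close>; such exchanges never touch \<open>I\<close>.\<close>

lemma indep_extend_within:
  assumes M: "matroid M" and "A \<in> M" "B \<in> M" "I \<subseteq> A"
  obtains A' where "A' \<in> M" "I \<subseteq> A'" "A' \<subseteq> I \<union> B"
proof -
  have "\<exists>A'\<in>M. I \<subseteq> A' \<and> A' \<subseteq> I \<union> B"
    using assms(2,4)
  proof (induction "card (A - (I \<union> B))" arbitrary: A rule: less_induct)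
    case less
    show ?case
    proof (cases "A \<subseteq> I \<union> B")
      case False
      then obtain a where a: "a \<in> A" "a \<notin> I" "a \<notin> B" by blast
      then obtain b where b: "b \<in> B" "b \<notin> A" "insert b (A - {a}) \<in> M"
        using matroid_exchange[OF M less.prems(1) \<open>B \<in> M\<close>] by blast
      have "card (insert b (A - {a}) - (I \<union> B)) < card (A - (I \<union> B))"
        using a b by (intro psubset_card_mono) auto
      from less.hyps[OF this b(3)] show ?thesis
        using a b less.prems by auto
    qed (use less.prems in auto)
  qed
  then show thesis using that by blast
qed

text \<open>Extend \<open>I\<close> to a basis using only elements of a basis \<open>B\<close>
  containing \<open>J\<close>. If no element of \<open>J - I\<close> were used, this basis would lie
  in \<open>I \<union> (B - J)\<close>, which has fewer elements than \<open>B\<close>.\<close>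

lemma indep_augment:
  assumes M: "matroid M" and "indep M I" "indep M J" "card I < card J"
  obtains x where "x \<in> J" "x \<notin> I" "indep M (insert x I)"
proof -
  obtain A B where "A \<in> M" "I \<subseteq> A" "B \<in> M" "J \<subseteq> B"
    using assms unfolding indep_def by blast
  then obtain A' where A': "A' \<in> M" "I \<subseteq> A'" "A' \<subseteq> I \<union> B"
    using indep_extend_within[OF M] by metis
  have "\<not> A' \<subseteq> I \<union> (B - J)"
  proof
    assume "A' \<subseteq> I \<union> (B - J)"
    then have "card A' \<le> card (I \<union> (B - J))"
      by (intro card_mono) auto
    also have "\<dots> \<le> card I + card (B - J)"
      by (rule card_Un_le)
    also have "\<dots> < card J + card (B - J)"
      using assms by simp
    also have "\<dots> = card B"
      using \<open>J \<subseteq> B\<close> by (simp add: card_Diff_subset card_mono)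
    finally show False
      using bases_card_eq[OF M \<open>A' \<in> M\<close> \<open>B \<in> M\<close>] by simp
  qed
  then obtain x where "x \<in> A'" "x \<in> J" "x \<notin> I"
    using A'(3) by blast
  with A' show thesis
    by (intro that[of x]) (auto simp: indep_def)
qed

lemma indep_subset: "indep M J \<Longrightarrow> I \<subseteq> J \<Longrightarrow> indep M I"
  unfolding indep_def by blast

lemma card_le_rk: "indep M I \<Longrightarrow> I \<subseteq> A \<Longrightarrow> card I \<le> rk M A"
  unfolding rk_def by (intro Max_ge) auto

lemma basis_Int_card_le: "B \<in> M \<Longrightarrow> card (B \<inter> A) \<le> rk M A"
  by (rule card_le_rk) (auto simp: indep_def)

lemma indep_empty: "matroid M \<Longrightarrow> indep M {}"
  unfolding matroid_def indep_def by auto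

lemma rk_attained:
  assumes "M \<noteq> {}"
  obtains I where "I \<subseteq> A" "indep M I" "card I = rk M A"
proof -
  have "indep M {}" using assms by (auto simp: indep_def)
  then have "card ` {I. I \<subseteq> A \<and> indep M I} \<noteq> {}"
    by blast
  from Max_in[OF _ this] show thesis
    unfolding rk_def[symmetric] using that by auto
qed

text \<open>Augment \<open>I\<close> step by step from an independent \<open>K \<subseteq> A\<close>
  of maximal size.\<close>

lemma indep_extend_rk:
  assumes M: "matroid M" and "indep M I" "I \<subseteq> A"
  obtains J where "indep M J" "I \<subseteq> J" "J \<subseteq> A" "card J = rk M A"
proof -
  obtain K where K: "K \<subseteq> A" "indep M K" "card K = rk M A"
    using rk_attained M unfolding matroid_def by metis
  have "\<exists>J. indep M J \<and> I \<subseteq> J \<and> J \<subseteq> A \<and> card J = rk M A"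
    using assms(2,3)
  proof (induction "rk M A - card I" arbitrary: I rule: less_induct)
    case less
    have le: "card I \<le> rk M A"
      using less.prems by (rule card_le_rk)
    show ?case
    proof (cases "card I = rk M A")
      case False
      then obtain x where x: "x \<in> K" "x \<notin> I" "indep M (insert x I)"
        using indep_augment[OF M less.prems(1) K(2)] K(3) le by (metis le_neq_implies_less)
      have "rk M A - card (insert x I) < rk M A - card I"
        using x False le by simp
      from less.hyps[OF this x(3)] show ?thesis
        using x K less.prems by auto
    qed (use less.prems in auto)
  qed
  then show thesis using that by blast
qed

lemma basis_card:
  assumes "matroid M" "B \<in> M"
  shows "card B = rk M UNIV"
proof -
  obtain I where I: "indep M I" "card I = rk M UNIV"
    using rk_attained assms unfolding matroid_def by metis
  then obtain A where A: "A \<in> M" "I \<subseteq> A"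
    unfolding indep_def by blast
  have "rk M UNIV \<le> card A"
    using I A by (metis card_mono finite)
  moreover have "card B \<le> rk M UNIV"
    using basis_Int_card_le[OF assms(2), of UNIV] by simp
  ultimately show ?thesis
    using bases_card_eq[OF assms(1) A(1) assms(2)] by simp
qed

text \<open>Greedy algorithm, by induction from the smallest member upwards: the set found for the
  smaller members is enlarged to a maximal independent subset of the top member.\<close>

lemma chain_adapted_indep:
  assumes M: "matroid M" and "chain\<^sub>\<subseteq> \<C>"
  shows "\<exists>I. indep M I \<and> I \<subseteq> \<Union>\<C> \<and> (\<forall>F\<in>\<C>. card (I \<inter> F) = rk M F)"
  using finite[of \<C>] assms(2)
proof (induction \<C> rule: finite_psubset_induct)
  case (psubset \<C>)
  show ?case
  proof (cases "\<C> = {}")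
    case True
    then show ?thesis using indep_empty[OF M] by auto
  next
    case False
    define F where "F = \<Union>\<C>"
    have F: "F \<in> \<C>"
      unfolding F_def using chain_subset_top_mem psubset.prems psubset.hyps False by blast
    have "chain\<^sub>\<subseteq> (\<C> - {F})"
      using psubset.prems unfolding chain_subset_def by blast
    then obtain I where I: "indep M I" "I \<subseteq> \<Union>(\<C> - {F})" "\<forall>G\<in>\<C> - {F}. card (I \<inter> G) = rk M G"
      using psubset.IH[of "\<C> - {F}"] F by blast
    obtain J where J: "indep M J" "I \<subseteq> J" "J \<subseteq> F" "card J = rk M F"
      using indep_extend_rk[OF M I(1), of F] I(2) unfolding F_def by blast
    have "card (J \<inter> G) = rk M G" if "G \<in> \<C>" for G
    proof (cases "G = F")
      case True
      then show ?thesis using J by (simp add: Int_absorb2)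
    next
      case False
      \<comment> \<open>The enlargement does no harm below: \<open>I\<close> already meets
        \<open>G\<close> in as many elements as an independent set can.\<close>
      have "rk M G = card (I \<inter> G)" using I False that by simp
      also have "\<dots> \<le> card (J \<inter> G)" using J by (intro card_mono) auto
      finally show ?thesis
        using card_le_rk[OF indep_subset[OF J(1)], of "J \<inter> G" G] by simp
    qed
    then show ?thesis using J by (auto simp: F_def)
  qed
qed

lemma chain_adapted_basis:
  assumes M: "matroid M" and "chain\<^sub>\<subseteq> \<C>"
  obtains B where "B \<in> M" "\<And>F. F \<in> \<C> \<Longrightarrow> card (B \<inter> F) = rk M F"
proof -
  obtain I B where I: "\<forall>F\<in>\<C>. card (I \<inter> F) = rk M F" and B: "B \<in> M" "I \<subseteq> B"
    using chain_adapted_indep[OF assms] unfolding indep_def by blast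
  have "card (B \<inter> F) = rk M F" if "F \<in> \<C>" for F
  proof (rule antisym[OF basis_Int_card_le[OF B(1)]])
    have "rk M F = card (I \<inter> F)" using I that by simp
    also have "\<dots> \<le> card (B \<inter> F)" using B by (intro card_mono) auto
    finally show "rk M F \<le> card (B \<inter> F)" .
  qed
  with B show thesis using that by blast
qed

section \<open>Initial matroids of positive combinations of a chain\<close>

text \<open>This is \<open>\<Sum> c F v_F\<close> written by coordinates. It is polymorphic because
  integral vectors index the zeta functions, while real ones form the cone of a flag.\<close>

definition flag_vec :: "'e::finite set set \<Rightarrow> ('e set \<Rightarrow> 'b::linordered_idom) \<Rightarrow> 'b ^ 'e" where
  "flag_vec \<C> c = (\<chi> e. \<Sum>F | F \<in> \<C> \<and> e \<in> F. c F)"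

text \<open>With a basis for \<open>B\<close> this computes weights, with \<open>UNIV\<close> the
  coordinate sum.\<close>

lemma sum_flag_vec: "(\<Sum>e\<in>B. flag_vec \<C> c $ e) = (\<Sum>F\<in>\<C>. c F * of_nat (card (B \<inter> F)))"
proof -
  have "(\<Sum>e\<in>B. flag_vec \<C> c $ e) = (\<Sum>e\<in>B. \<Sum>F\<in>\<C>. if e \<in> F then c F else 0)"
    by (simp add: flag_vec_def sum.If_cases Int_def)
  also have "\<dots> = (\<Sum>F\<in>\<C>. \<Sum>e\<in>B. if e \<in> F then c F else 0)"
    by (rule sum.swap)
  also have "\<dots> = (\<Sum>F\<in>\<C>. c F * of_nat (card (B \<inter> F)))"
    by (simp add: sum.If_cases Int_def mult.commute)
  finally show ?thesis .
qed

text \<open>A description of the initial matroid without a weight vector. Arbitrary families are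
  allowed, since the chain of a vector need not consist of flats.\<close>

definition chain_matroid :: "'e::finite set set \<Rightarrow> 'e set set \<Rightarrow> 'e set set" where
  "chain_matroid M \<C> = {B \<in> M. \<forall>F\<in>\<C>. card (B \<inter> F) = rk M F}"

text \<open>Each summand is bounded by \<open>c F\<close> times the rank of \<open>F\<close>, and an
  adapted basis attains all these bounds at once.\<close>

lemma wt_flag_vec:
  fixes c :: "'e::finite set \<Rightarrow> 'b::linordered_idom"
  assumes M: "matroid M" and \<C>: "chain\<^sub>\<subseteq> \<C>" and c: "\<And>F. F \<in> \<C> \<Longrightarrow> 0 < c F"
  shows "wt M (flag_vec \<C> c) = (\<Sum>F\<in>\<C>. c F * of_nat (rk M F))"
proof -
  obtain B where B: "B \<in> M" "\<And>F. F \<in> \<C> \<Longrightarrow> card (B \<inter> F) = rk M F"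
    using chain_adapted_basis[OF M \<C>] by blast
  show ?thesis
    unfolding wt_def sum_flag_vec
  proof (rule Max_eqI)
    show "(\<Sum>F\<in>\<C>. c F * of_nat (rk M F)) \<in> (\<lambda>B. \<Sum>F\<in>\<C>. c F * of_nat (card (B \<inter> F))) ` M"
      using B by (intro image_eqI[of _ _ B]) auto
    fix y assume "y \<in> (\<lambda>B. \<Sum>F\<in>\<C>. c F * of_nat (card (B \<inter> F))) ` M"
    then obtain B' where "B' \<in> M" and y: "y = (\<Sum>F\<in>\<C>. c F * of_nat (card (B' \<inter> F)))"
      by blast
    then show "y \<le> (\<Sum>F\<in>\<C>. c F * of_nat (rk M F))"
      unfolding y by (intro sum_mono mult_left_mono of_nat_mono basis_Int_card_le less_imp_le[OF c])
  qed simp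
qed

text \<open>A basis reaches the sum of the termwise upper bounds iff it reaches every one of them,
  and the positive coefficients cancel.\<close>

lemma initial_flag_vec:
  fixes c :: "'e::finite set \<Rightarrow> 'b::linordered_idom"
  assumes M: "matroid M" and \<C>: "chain\<^sub>\<subseteq> \<C>" and c: "\<And>F. F \<in> \<C> \<Longrightarrow> 0 < c F"
  shows "initial M (flag_vec \<C> c) = chain_matroid M \<C>"
proof -
  have "(\<Sum>F\<in>\<C>. c F * of_nat (card (B \<inter> F))) = (\<Sum>F\<in>\<C>. c F * of_nat (rk M F)) \<longleftrightarrow>
      (\<forall>F\<in>\<C>. card (B \<inter> F) = rk M F)" (is "?l = ?r \<longleftrightarrow> _")
    if "B \<in> M" for B
  proof -
    have le: "c F * of_nat (card (B \<inter> F)) \<le> c F * of_nat (rk M F)" if "F \<in> \<C>" for F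
      using \<open>B \<in> M\<close> that by (intro mult_left_mono of_nat_mono basis_Int_card_le less_imp_le[OF c])
    have "?l = ?r \<longleftrightarrow> ?r - ?l = 0"
      by auto
    also have "?r - ?l = (\<Sum>F\<in>\<C>. c F * of_nat (rk M F) - c F * of_nat (card (B \<inter> F)))"
      by (rule sum_subtractf[symmetric])
    also have "\<dots> = 0 \<longleftrightarrow> (\<forall>F\<in>\<C>. c F * of_nat (rk M F) - c F * of_nat (card (B \<inter> F)) = 0)"
      by (rule sum_nonneg_eq_0_iff) (use le in auto)
    also have "\<dots> \<longleftrightarrow> (\<forall>F\<in>\<C>. card (B \<inter> F) = rk M F)"
    proof (intro ball_cong refl)
      fix F assume "F \<in> \<C>"
      with c[of F] show "c F * of_nat (rk M F) - c F * of_nat (card (B \<inter> F)) = 0 \<longleftrightarrow> card (B \<inter> F) = rk M F"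
        by auto
    qed
    finally show ?thesis .
  qed
  moreover have "wt M (flag_vec \<C> c) = (\<Sum>F\<in>\<C>. c F * of_nat (rk M F))"
    using wt_flag_vec M \<C> c by blast
  ultimately show ?thesis
    unfolding initial_def chain_matroid_def sum_flag_vec by auto
qed

text \<open>The terms of \<open>A\<close> and \<open>insert e A\<close> cancel.\<close>

lemma charpoly_loop:
  assumes "\<And>B. B \<in> N \<Longrightarrow> e \<notin> B"
  shows "charpoly N = 0"
proof -
  \<comment> \<open>No independent set contains \<open>e\<close>, so \<open>A\<close> and
    \<open>insert e A\<close> have the same independent subsets and the same rank.\<close>
  have ind: "I \<subseteq> insert e A \<and> indep N I \<longleftrightarrow> I \<subseteq> A \<and> indep N I" for I A
  proof -
    have "e \<notin> I" if "indep N I"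
      using that assms unfolding indep_def by auto
    then show ?thesis by auto
  qed
  have rk: "rk N (insert e A) = rk N A" for A
    unfolding rk_def ind ..
  let ?t = "\<lambda>A. monom ((-1) ^ card A) (rk N UNIV - rk N A) :: int poly"
  have "charpoly N = (\<Sum>A\<in>Pow (insert e (UNIV - {e})). ?t A)"
    by (simp add: charpoly_def insert_UNIV)
  also have "\<dots> = (\<Sum>A\<in>Pow (UNIV - {e}). ?t A) + (\<Sum>A\<in>Pow (UNIV - {e}). ?t (insert e A))"
  proof -
    have "inj_on (insert e) (Pow (UNIV - {e}))"
      by (auto simp: inj_on_def)
    then show ?thesis
      unfolding Pow_insert by (subst sum.union_disjoint) (auto simp: sum.reindex)
  qed
  also have "(\<Sum>A\<in>Pow (UNIV - {e}). ?t (insert e A)) = (\<Sum>A\<in>Pow (UNIV - {e}). - ?t A)"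
  proof (rule sum.cong)
    fix A assume "A \<in> Pow (UNIV - {e})"
    then have "e \<notin> A" by auto
    then show "?t (insert e A) = - ?t A" by (simp add: rk minus_monom)
  qed simp
  finally show ?thesis by (simp add: sum_negf)
qed

lemma cl_superset: "A \<subseteq> cl M A"
  by (auto simp: cl_def insert_absorb)

text \<open>Otherwise \<open>B\<close> would meet \<open>insert e F\<close> in one element more than
  its rank, which equals the rank of \<open>F\<close>.\<close>

lemma loop_if_in_cl_diff:
  assumes B: "B \<in> M" "card (B \<inter> F) = rk M F" and e: "e \<in> cl M F" "e \<notin> F"
  shows "e \<notin> B"
proof
  assume "e \<in> B"
  then have "Suc (rk M F) = card (B \<inter> insert e F)"
    using B e by (simp add: Int_insert_right)
  also have "\<dots> \<le> rk M (insert e F)"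
    by (rule basis_Int_card_le[OF B(1)])
  finally show False using e by (simp add: cl_def)
qed

lemma rk_empty: "M \<noteq> {} \<Longrightarrow> rk M {} = 0"
  by (rule rk_attained[of M "{}"]) auto

text \<open>A loop is found in either case. If \<open>M\<close> has none, the offending member is
  nonempty and thus fails to be a flat, and the elements its closure adds become loops. A loop of
  \<open>M\<close> itself avoids all bases; this is the case of \<open>{}\<close> in
  \<open>loop_if_in_cl_diff\<close>.\<close>

lemma charpoly_chain_matroid_eq_0:
  assumes M: "matroid M" and \<C>: "chain\<^sub>\<subseteq> \<C>" "{} \<notin> \<C>" "\<C> \<notin> flags M"
  shows "charpoly (chain_matroid M \<C>) = 0"
proof -
  have M': "M \<noteq> {}" using M by (simp add: matroid_def)
  obtain F where F: "F \<in> \<C>" "\<not> (flat M F \<and> cl M {} \<subset> F)"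
    using \<C> unfolding flags_def by blast
  have "\<exists>e. \<forall>B\<in>chain_matroid M \<C>. e \<notin> B"
  proof (cases "cl M {} = {}")
    case True
    with F \<C> have "cl M F \<noteq> F"
      unfolding flat_def by auto
    then obtain e where "e \<in> cl M F" "e \<notin> F"
      using cl_superset by blast
    then show ?thesis
      using loop_if_in_cl_diff F(1) unfolding chain_matroid_def by blast
  next
    case False
    then obtain e where "e \<in> cl M {}" by blast
    then show ?thesis
      using loop_if_in_cl_diff[of _ M "{}" e] rk_empty[OF M'] unfolding chain_matroid_def by auto
  qed
  then show ?thesis using charpoly_loop by metis
qed

section \<open>Chain decomposition of nonnegative vectors\<close>

lemma flag_vec_nth: "vec_nth (flag_vec \<C> c) e = (\<Sum>F | F \<in> \<C> \<and> e \<in> F. c F)"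
  by (simp add: flag_vec_def)

text \<open>The empty set is excluded because its indicator vector is 0, which would leave its
  presence and its coefficient undetermined.\<close>

definition chain_families :: "'e::finite set set set" where
  "chain_families = {\<C>. chain\<^sub>\<subseteq> \<C> \<and> {} \<notin> \<C>}"

text \<open>The union of the members properly inside \<open>F\<close> is empty or itself such a
  member, so it misses some element of \<open>F\<close>.\<close>

lemma chain_families_fresh:
  assumes "\<C> \<in> chain_families" "F \<in> \<C>"
  obtains e where "e \<in> F" "\<And>G. G \<in> \<C> \<Longrightarrow> e \<in> G \<longleftrightarrow> F \<subseteq> G"
proof -
  have ch: "\<And>G H. G \<in> \<C> \<Longrightarrow> H \<in> \<C> \<Longrightarrow> G \<subseteq> H \<or> H \<subseteq> G"
    using assms by (auto simp: chain_families_def chain_subset_def)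
  define U where "U = \<Union>{G \<in> \<C>. G \<subset> F}"
  have "U \<noteq> F"
  proof (cases "{G \<in> \<C>. G \<subset> F} = {}")
    case True
    then have "U = {}" unfolding U_def by blast
    then show ?thesis using assms by (auto simp: chain_families_def)
  next
    case False
    have "chain\<^sub>\<subseteq> {G \<in> \<C>. G \<subset> F}"
      unfolding chain_subset_def using ch by simp
    from chain_subset_top_mem[OF this _ False] have "U \<in> {G \<in> \<C>. G \<subset> F}"
      unfolding U_def by simp
    then show ?thesis by blast
  qed
  moreover have "U \<subseteq> F" unfolding U_def by blast
  ultimately obtain e where e: "e \<in> F" "e \<notin> U" by blast
  have "e \<in> G \<longleftrightarrow> F \<subseteq> G" if "G \<in> \<C>" for G
    using ch[OF that assms(2)] e that unfolding U_def by auto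
  with e show thesis using that by blast
qed

text \<open>Members of the chain are superlevel sets of the vector. Outside \<open>F\<close>,
  comparability leaves only members properly containing \<open>F\<close>, so at least the positive
  term \<open>c F\<close> is missing.\<close>

lemma flag_vec_ge_iff:
  fixes c :: "'e::finite set \<Rightarrow> 'b::linordered_idom"
  assumes C: "\<C> \<in> chain_families" "\<And>G. G \<in> \<C> \<Longrightarrow> 0 < c G" and F: "F \<in> \<C>"
  shows "(\<Sum>G | G \<in> \<C> \<and> F \<subseteq> G. c G) \<le> vec_nth (flag_vec \<C> c) e \<longleftrightarrow> e \<in> F"
proof -
  have ch: "\<And>G H. G \<in> \<C> \<Longrightarrow> H \<in> \<C> \<Longrightarrow> G \<subseteq> H \<or> H \<subseteq> G"
    using assms by (auto simp: chain_families_def chain_subset_def)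
  show ?thesis
  proof (cases "e \<in> F")
    case True
    then show ?thesis
      unfolding flag_vec_nth by (auto intro!: sum_mono2 less_imp_le[OF C(2)])
  next
    case False
    have "{G \<in> \<C>. e \<in> G} \<subset> {G \<in> \<C>. F \<subseteq> G}"
      using ch[OF _ F] False F by blast
    then have "vec_nth (flag_vec \<C> c) e < (\<Sum>G | G \<in> \<C> \<and> F \<subseteq> G. c G)"
      unfolding flag_vec_nth using F False C(2)
      by (intro sum_strict_mono2[of _ _ F]) (auto intro: less_imp_le)
    then show ?thesis using False by simp
  qed
qed

text \<open>The right-hand side mentions only the vector, so the vector determines its
  chain.\<close>

lemma flag_vec_mem_iff:
  fixes c :: "'e::finite set \<Rightarrow> 'b::linordered_idom"
  assumes C: "\<C> \<in> chain_families" "\<And>G. G \<in> \<C> \<Longrightarrow> 0 < c G"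
  shows "F \<in> \<C> \<longleftrightarrow> F \<noteq> {} \<and> (\<exists>t>0. F = {e. t \<le> vec_nth (flag_vec \<C> c) e})"
proof
  assume F: "F \<in> \<C>"
  then have "F \<noteq> {}" using C by (auto simp: chain_families_def)
  moreover have "F = {e. (\<Sum>G | G \<in> \<C> \<and> F \<subseteq> G. c G) \<le> vec_nth (flag_vec \<C> c) e}"
    using flag_vec_ge_iff[of \<C> c, OF C F] by simp
  moreover have "0 < (\<Sum>G | G \<in> \<C> \<and> F \<subseteq> G. c G)"
    using F by (intro sum_pos C(2)) auto
  ultimately show "F \<noteq> {} \<and> (\<exists>t>0. F = {e. t \<le> vec_nth (flag_vec \<C> c) e})"
    by blast
next
  define w where "w = vec_nth (flag_vec \<C> c)"
  assume "F \<noteq> {} \<and> (\<exists>t>0. F = {e. t \<le> vec_nth (flag_vec \<C> c) e})"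
  then obtain t where t: "F \<noteq> {}" "0 < t" "F = {e. t \<le> w e}"
    unfolding w_def by blast
  \<comment> \<open>The threshold can be raised to the least value on \<open>F\<close>, which is
    attained at \<open>e\<close>.\<close>
  define e where "e = arg_min_on w F"
  have e: "e \<in> F" "\<And>e'. e' \<in> F \<Longrightarrow> w e \<le> w e'"
    using t arg_min_if_finite[of F w] unfolding e_def by (auto simp: not_less)
  then have Fe: "F = {e'. w e \<le> w e'}"
    using t by auto
  have ne: "{G \<in> \<C>. e \<in> G} \<noteq> {}"
  proof
    assume "{G \<in> \<C>. e \<in> G} = {}"
    then have "w e = 0" unfolding w_def flag_vec_nth by (simp only: sum.empty)
    then show False using e(1) t by simp
  qed
  have ch: "\<And>G H. G \<in> \<C> \<Longrightarrow> H \<in> \<C> \<Longrightarrow> G \<subseteq> H \<or> H \<subseteq> G"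
    using assms by (auto simp: chain_families_def chain_subset_def)
  \<comment> \<open>For the smallest member \<open>G\<close> containing \<open>e\<close>, the
    members above \<open>G\<close> are exactly those containing \<open>e\<close>. Hence the
    threshold of \<open>G\<close> is \<open>w e\<close>, and \<open>G\<close> equals
    \<open>F\<close>.\<close>
  obtain G where G: "G \<in> \<C>" "e \<in> G" "\<And>H. H \<in> \<C> \<Longrightarrow> e \<in> H \<Longrightarrow> card G \<le> card H"
    using arg_min_if_finite[of "{G \<in> \<C>. e \<in> G}" card] ne by (auto simp: not_less)
  have "{H \<in> \<C>. G \<subseteq> H} = {H \<in> \<C>. e \<in> H}"
  proof (intro Collect_cong conj_cong refl)
    fix H assume H: "H \<in> \<C>"
    show "G \<subseteq> H \<longleftrightarrow> e \<in> H"
      using G(2) G(3)[OF H] ch[OF G(1) H] card_seteq[of G H] by auto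
  qed
  then have "(\<Sum>H | H \<in> \<C> \<and> G \<subseteq> H. c H) = w e"
    unfolding w_def flag_vec_nth by simp
  then have "G = F"
    using flag_vec_ge_iff[of \<C> c, OF C G(1)] unfolding Fe w_def by auto
  then show "F \<in> \<C>" using G by simp
qed

text \<open>The chains agree by \<open>flag_vec_mem_iff\<close>. The coefficients agree by induction
  from large members to small ones: at a fresh element of \<open>F\<close> the coordinate is
  \<open>c F\<close> plus coefficients of strictly larger members.\<close>

lemma flag_vec_unique:
  fixes c d :: "'e::finite set \<Rightarrow> 'b::linordered_idom"
  assumes C: "\<C> \<in> chain_families" "\<And>G. G \<in> \<C> \<Longrightarrow> 0 < c G"
    and D: "\<D> \<in> chain_families" "\<And>G. G \<in> \<D> \<Longrightarrow> 0 < d G"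
    and eq: "flag_vec \<C> c = flag_vec \<D> d"
  shows "\<C> = \<D>" and "\<And>F. F \<in> \<C> \<Longrightarrow> c F = d F"
proof -
  show CD: "\<C> = \<D>"
  proof (rule set_eqI)
    fix F
    have "F \<in> \<C> \<longleftrightarrow> F \<noteq> {} \<and> (\<exists>t>0. F = {e. t \<le> vec_nth (flag_vec \<C> c) e})"
      using C by (rule flag_vec_mem_iff)
    also have "\<dots> \<longleftrightarrow> F \<in> \<D>"
      unfolding eq by (rule flag_vec_mem_iff[symmetric]) (use D in auto)
    finally show "F \<in> \<C> \<longleftrightarrow> F \<in> \<D>" .
  qed
  show "c F = d F" if "F \<in> \<C>" for F
    using that
  proof (induction "card (- F)" arbitrary: F rule: less_induct)
    case less
    obtain e where e: "\<And>G. G \<in> \<C> \<Longrightarrow> e \<in> G \<longleftrightarrow> F \<subseteq> G"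
      using chain_families_fresh[OF C(1) less.prems] by metis
    have "{G \<in> \<C>. e \<in> G} = insert F {G \<in> \<C>. F \<subset> G}"
      using e less.prems by auto
    then have *: "vec_nth (flag_vec \<C> b) e = b F + (\<Sum>G | G \<in> \<C> \<and> F \<subset> G. b G)" for b :: "'e set \<Rightarrow> 'b"
      unfolding flag_vec_nth by simp
    have "(\<Sum>G | G \<in> \<C> \<and> F \<subset> G. c G) = (\<Sum>G | G \<in> \<C> \<and> F \<subset> G. d G)"
      by (intro sum.cong refl less.hyps psubset_card_mono) auto
    then show ?case
      using *[of c] *[of d] eq CD by simp
  qed
qed

text \<open>Peel off the support \<open>S\<close> with the least positive entry \<open>m\<close> as
  its coefficient and recurse on the rest.\<close>

lemma nonneg_eq_flag_vec:
  fixes w :: "int ^ 'e::finite"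
  assumes "\<And>e. 0 \<le> vec_nth w e"
  shows "\<exists>\<C>\<in>chain_families. \<exists>c. (\<forall>F\<in>\<C>. 0 < c F) \<and> w = flag_vec \<C> (\<lambda>F. int (c F))"
  using assms
proof (induction "card {e. vec_nth w e > 0}" arbitrary: w rule: less_induct)
  case less
  define S where "S = {e. vec_nth w e > 0}"
  show ?case
  proof (cases "S = {}")
    case True
    then have "vec_nth w e = 0" for e
      using less.prems[of e] unfolding S_def by (simp add: order.antisym not_less)
    then have "w = flag_vec {} (\<lambda>F. int 0)"
      by (simp add: vec_eq_iff flag_vec_nth)
    then show ?thesis
      by (intro bexI[of _ "{}"] exI[of _ "\<lambda>_. 0"]) (auto simp: chain_families_def chain_subset_def)
  next
    case False
    define m where "m = Min (vec_nth w ` S)"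
    have m_le: "m \<le> vec_nth w e" if "e \<in> S" for e
      unfolding m_def using that by (intro Min_le) auto
    have "m \<in> vec_nth w ` S"
      unfolding m_def using False by (intro Min_in) auto
    then obtain e0 where e0: "e0 \<in> S" "vec_nth w e0 = m" by auto
    have m: "m > 0" using e0 by (auto simp: S_def)
    \<comment> \<open>The entry at \<open>e0\<close> drops to 0, so the support shrinks
      strictly.\<close>
    define w' where "w' = (\<chi> e. if e \<in> S then vec_nth w e - m else 0)"
    have pos: "{e. vec_nth w' e > 0} \<subset> S"
      using e0 by (auto simp: w'_def)
    then have "card {e. vec_nth w' e > 0} < card {e. vec_nth w e > 0}"
      unfolding S_def[symmetric] by (intro psubset_card_mono) auto
    moreover have "0 \<le> vec_nth w' e" for e
      using m_le by (auto simp: w'_def)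
    ultimately obtain \<C> c where C: "\<C> \<in> chain_families" "\<forall>F\<in>\<C>. 0 < c F"
      and w': "w' = flag_vec \<C> (\<lambda>F. int (c F))"
      using less.hyps by blast
    \<comment> \<open>Members of the chain of \<open>w'\<close> lie in the support of
      \<open>w'\<close>, so \<open>S\<close> can be added as a new top member.\<close>
    have sub: "F \<subset> S" if "F \<in> \<C>" for F
    proof -
      have "vec_nth w' e > 0" if "e \<in> F" for e
        unfolding w' flag_vec_nth using C \<open>F \<in> \<C>\<close> that by (intro sum_pos) auto
      then show ?thesis using pos by blast
    qed
    then have "S \<notin> \<C>" by blast
    let ?c = "c(S := nat m)"
    have "w = flag_vec (insert S \<C>) (\<lambda>F. int (?c F))"
    proof (subst vec_eq_iff, rule allI)
      fix e
      show "vec_nth w e = vec_nth (flag_vec (insert S \<C>) (\<lambda>F. int (?c F))) e"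
      proof (cases "e \<in> S")
        case True
        then have "{F \<in> insert S \<C>. e \<in> F} = insert S {F \<in> \<C>. e \<in> F}" by auto
        moreover have "(\<Sum>F | F \<in> \<C> \<and> e \<in> F. int (?c F)) = vec_nth w' e"
          unfolding w' flag_vec_nth using \<open>S \<notin> \<C>\<close> by (intro sum.cong) auto
        ultimately show ?thesis
          unfolding flag_vec_nth using True m \<open>S \<notin> \<C>\<close> by (simp add: w'_def)
      next
        case False
        then have "{F \<in> insert S \<C>. e \<in> F} = {}" using sub by blast
        moreover have "vec_nth w e = 0"
          using False less.prems[of e] by (simp add: S_def)
        ultimately show ?thesis unfolding flag_vec_nth by (simp only: sum.empty)
      qed
    qed
    moreover have "insert S \<C> \<in> chain_families"
      using C(1) sub False by (auto simp: chain_families_def chain_subset_def)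
    moreover have "\<forall>F\<in>insert S \<C>. 0 < ?c F"
      using C(2) m by simp
    ultimately show ?thesis by blast
  qed
qed

text \<open>If all entries are positive, the chain covers the ground set, and the union of a
  nonempty finite chain is a member.\<close>

lemma flag_vec_pos_iff:
  fixes c :: "'e::finite set \<Rightarrow> 'b::linordered_idom"
  assumes C: "\<C> \<in> chain_families" "\<And>G. G \<in> \<C> \<Longrightarrow> 0 < c G"
  shows "(\<forall>e. 0 < vec_nth (flag_vec \<C> c) e) \<longleftrightarrow> UNIV \<in> \<C>"
proof
  assume "UNIV \<in> \<C>"
  then show "\<forall>e. 0 < vec_nth (flag_vec \<C> c) e"
    unfolding flag_vec_nth by (auto intro!: sum_pos C(2))
next
  assume pos: "\<forall>e. 0 < vec_nth (flag_vec \<C> c) e"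
  have "e \<in> \<Union>\<C>" for e
  proof (rule ccontr)
    assume "e \<notin> \<Union>\<C>"
    then have "{F \<in> \<C>. e \<in> F} = {}" by blast
    then have "vec_nth (flag_vec \<C> c) e = 0" unfolding flag_vec_nth by (simp only: sum.empty)
    with pos show False by (metis less_irrefl)
  qed
  then have U: "\<Union>\<C> = UNIV" by blast
  then have "\<C> \<noteq> {}" by auto
  then show "UNIV \<in> \<C>"
    using chain_subset_top_mem[of \<C>] C(1) U by (simp add: chain_families_def)
qed

text \<open>The predicate \<open>P\<close> covers several index sets at once. Coefficients are taken
  in \<open>PiE\<close> so that their values off the chain are fixed, as injectivity
  requires.\<close>

lemma flag_vec_bij_betw:
  "bij_betw (\<lambda>(\<C>, c). flag_vec \<C> (\<lambda>F. int (c F)))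
     (SIGMA \<C>:{\<C> \<in> chain_families. P (UNIV \<in> \<C>)}. PiE \<C> (\<lambda>_. {1..}))
     {w :: int ^ 'e::finite. (\<forall>e. 0 \<le> vec_nth w e) \<and> P (\<forall>e. 0 < vec_nth w e)}"
  (is "bij_betw ?f ?S ?W")
proof -
  have pos: "0 < int (c F)" if "c \<in> PiE \<C> (\<lambda>_. {1..})" "F \<in> \<C>" for c :: "'e set \<Rightarrow> nat" and F \<C>
    using PiE_mem[OF that] by simp
  have "inj_on ?f ?S"
  proof (rule inj_onI, clarify)
    fix \<C> \<D> :: "'e set set" and c d :: "'e set \<Rightarrow> nat"
    assume *: "\<C> \<in> chain_families" "\<D> \<in> chain_families" and c: "c \<in> PiE \<C> (\<lambda>_. {1..})"
      and d: "d \<in> PiE \<D> (\<lambda>_. {1..})"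
      and eq: "flag_vec \<C> (\<lambda>F. int (c F)) = flag_vec \<D> (\<lambda>F. int (d F))"
    have posc: "\<And>F. F \<in> \<C> \<Longrightarrow> 0 < int (c F)" and posd: "\<And>F. F \<in> \<D> \<Longrightarrow> 0 < int (d F)"
      using pos c d by blast+
    note u = flag_vec_unique[of \<C> "\<lambda>F. int (c F)" \<D> "\<lambda>F. int (d F)", OF *(1) posc *(2) posd eq]
    have "c = d"
    proof (rule PiE_ext[OF c])
      show "d \<in> PiE \<C> (\<lambda>_. {1..})" using d u(1) by simp
    qed (use u(2) in simp)
    with u(1) show "\<C> = \<D> \<and> c = d" by simp
  qed
  moreover have "?f ` ?S = ?W"
  proof (intro equalityI subsetI)
    fix w assume "w \<in> ?f ` ?S"
    then obtain \<C> c where C: "\<C> \<in> chain_families" "P (UNIV \<in> \<C>)" "c \<in> PiE \<C> (\<lambda>_. {1..})"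
      and w: "w = flag_vec \<C> (\<lambda>F. int (c F))"
      by auto
    show "w \<in> ?W"
      using C(2) flag_vec_pos_iff[of \<C> "\<lambda>F. int (c F)", OF C(1) pos[OF C(3)]] unfolding w
      by (auto simp: flag_vec_nth intro!: sum_nonneg)
  next
    fix w assume w: "w \<in> ?W"
    then obtain \<C> c where C: "\<C> \<in> chain_families" "\<forall>F\<in>\<C>. 0 < c F"
      and eq: "w = flag_vec \<C> (\<lambda>F. int (c F))"
      using nonneg_eq_flag_vec[of w] by blast
    \<comment> \<open>Values off the chain do not enter the vector, so \<open>c\<close> may be made
      extensional.\<close>
    have "flag_vec \<C> (\<lambda>F. int (restrict c \<C> F)) = w"
      unfolding eq by (auto simp: vec_eq_iff flag_vec_nth intro!: sum.cong)
    moreover have "P (UNIV \<in> \<C>)"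
      using flag_vec_pos_iff[OF C(1), of "\<lambda>F. int (c F)"] C(2) w unfolding eq by simp
    moreover have "restrict c \<C> \<in> PiE \<C> (\<lambda>_. {1..})"
      using C(2) by (auto simp: Suc_le_eq)
    ultimately show "w \<in> ?f ` ?S"
      using C(1) by (intro image_eqI[of _ _ "(\<C>, restrict c \<C>)"]) auto
  qed
  ultimately show ?thesis unfolding bij_betw_def ..
qed

section \<open>The matroid of a flag\<close>

lemma flag_vec_add: "flag_vec \<C> a + flag_vec \<C> b = flag_vec \<C> (\<lambda>F. a F + b F)"
  by (simp add: vec_eq_iff flag_vec_nth sum.distrib)

lemma flag_vec_scaleR: "r *\<^sub>R flag_vec \<C> c = flag_vec \<C> (\<lambda>F. r * c F)"
  by (simp add: vec_eq_iff flag_vec_nth sum_distrib_left)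

lemma indicator_vec_eq_flag_vec:
  assumes "F \<in> \<C>"
  shows "indicator_vec F = flag_vec \<C> (\<lambda>G. if G = F then 1 else 0)"
proof (subst vec_eq_iff, rule allI)
  fix e
  have "(\<Sum>G | G \<in> \<C> \<and> e \<in> G. if G = F then 1 else 0 :: real) = (if F \<in> {G \<in> \<C>. e \<in> G} then 1 else 0)"
    by (rule sum.delta) simp
  then show "vec_nth (indicator_vec F) e = vec_nth (flag_vec \<C> (\<lambda>G. if G = F then 1 else 0)) e"
    unfolding flag_vec_nth using assms by (simp add: indicator_vec_def indicator_def)
qed

text \<open>The nonnegative combinations form a convex cone containing the generators. Asking for
  nonnegativity at all sets is harmless, as \<open>flag_vec\<close> ignores values off the
  chain.\<close>

lemma convex_cone_hull_indicator_subset: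
  "convex_cone hull (indicator_vec ` \<C>) \<subseteq> {flag_vec \<C> c |c. \<forall>F. 0 \<le> c F}"
proof (rule hull_minimal)
  show "indicator_vec ` \<C> \<subseteq> {flag_vec \<C> c |c. \<forall>F. 0 \<le> c F}"
  proof (rule image_subsetI)
    fix F assume "F \<in> \<C>"
    then show "indicator_vec F \<in> {flag_vec \<C> c |c. \<forall>F. 0 \<le> c F}"
      unfolding indicator_vec_eq_flag_vec[OF \<open>F \<in> \<C>\<close>]
      by (intro CollectI exI[of _ "\<lambda>G. if G = F then 1 else 0"]) auto
  qed
  have 0: "(0 :: real ^ 'a) = flag_vec \<C> (\<lambda>_. 0)"
    by (simp add: vec_eq_iff flag_vec_nth)
  show "convex_cone {flag_vec \<C> c |c. \<forall>F. (0::real) \<le> c F}"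
    unfolding convex_cone_iff
  proof (intro conjI ballI allI impI)
    show "0 \<in> {flag_vec \<C> c |c. \<forall>F. (0::real) \<le> c F}"
      unfolding 0 by auto
  next
    fix x y assume "x \<in> {flag_vec \<C> c |c. \<forall>F. (0::real) \<le> c F}" "y \<in> {flag_vec \<C> c |c. \<forall>F. (0::real) \<le> c F}"
    then obtain a b where "x = flag_vec \<C> a" "y = flag_vec \<C> b" "\<forall>F. 0 \<le> a F" "\<forall>F. 0 \<le> b F"
      by auto
    then show "x + y \<in> {flag_vec \<C> c |c. \<forall>F. (0::real) \<le> c F}"
      by (auto simp: flag_vec_add intro!: exI[of _ "\<lambda>F. a F + b F"])
  next
    fix x and r :: real assume "x \<in> {flag_vec \<C> c |c. \<forall>F. (0::real) \<le> c F}" "0 \<le> r"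
    then obtain a where "x = flag_vec \<C> a" "\<forall>F. 0 \<le> a F"
      by auto
    with \<open>0 \<le> r\<close> show "r *\<^sub>R x \<in> {flag_vec \<C> c |c. \<forall>F. (0::real) \<le> c F}"
      by (auto simp: flag_vec_scaleR intro!: exI[of _ "\<lambda>F. r * a F"])
  qed
qed

text \<open>The sum of all generators serves as the point from which relative interior points are
  pushed away.\<close>

lemma flag_vec_1_in_convex_cone_hull: "flag_vec \<C> (\<lambda>_. 1) \<in> convex_cone hull (indicator_vec ` \<C>)"
proof -
  let ?S = "convex_cone hull (indicator_vec ` \<C>)"
  have cone: "convex_cone ?S" by (rule convex_cone_convex_cone_hull)
  have "(\<Sum>F\<in>\<D>. indicator_vec F) \<in> ?S" if "\<D> \<subseteq> \<C>" for \<D>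
    using finite[of \<D>] that
  proof (induction \<D> rule: finite_induct)
    case empty
    then show ?case using convex_cone_contains_0[OF cone] by simp
  next
    case (insert F \<D>)
    then have "indicator_vec F \<in> ?S" "sum indicator_vec \<D> \<in> ?S"
      by (auto intro: hull_inc)
    then show ?case
      using convex_cone_add[OF cone] insert.hyps by simp
  qed
  moreover have "flag_vec \<C> (\<lambda>_. 1) = (\<Sum>F\<in>\<C>. indicator_vec F)"
    by (simp add: vec_eq_iff flag_vec_nth indicator_vec_def indicator_def sum.If_cases Int_def)
  ultimately show ?thesis by simp
qed

text \<open>
  A relative interior point can be pushed slightly away from \<open>\<Sum> v\<^sub>F\<close> within the cone, so it is
  a convex combination, with positive weight on \<open>\<Sum> v\<^sub>F\<close>, of two points of the cone.
\<close>

lemma rel_interior_convex_cone_hull_indicator: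
  assumes "w \<in> rel_interior (convex_cone hull (indicator_vec ` \<C>))"
  obtains c where "w = flag_vec \<C> c" "\<And>F. 0 < c F"
proof -
  let ?S = "convex_cone hull (indicator_vec ` \<C>)"
  have "convex ?S" "?S \<noteq> {}"
    using convex_cone_convex_cone_hull unfolding convex_cone_def by blast+
  then obtain r where r: "r > 1" "(1 - r) *\<^sub>R flag_vec \<C> (\<lambda>_. 1) + r *\<^sub>R w \<in> ?S"
    using assms flag_vec_1_in_convex_cone_hull convex_rel_interior_iff by blast
  then obtain a where a: "(1 - r) *\<^sub>R flag_vec \<C> (\<lambda>_. 1) + r *\<^sub>R w = flag_vec \<C> a" "\<And>F. 0 \<le> a F"
    using convex_cone_hull_indicator_subset[of \<C>] by blast
  have "r *\<^sub>R w = flag_vec \<C> a + (r - 1) *\<^sub>R flag_vec \<C> (\<lambda>_. 1)"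
    unfolding a(1)[symmetric] by (simp add: scaleR_diff_left)
  then have "r *\<^sub>R w = flag_vec \<C> (\<lambda>F. a F + (r - 1))"
    by (simp add: flag_vec_scaleR flag_vec_add)
  then have "(1 / r) *\<^sub>R (r *\<^sub>R w) = flag_vec \<C> (\<lambda>F. 1 / r * (a F + (r - 1)))"
    by (simp only: flag_vec_scaleR)
  then have "w = flag_vec \<C> (\<lambda>F. 1 / r * (a F + (r - 1)))"
    using r by simp
  moreover have "0 < 1 / r * (a F + (r - 1))" for F
    using r a(2)[of F] by (intro mult_pos_pos) auto
  ultimately show thesis by (rule that)
qed

text \<open>All relative interior points have this initial matroid, and there is such a point
  because a nonempty convex set has nonempty relative interior; so the definite description is
  justified.\<close>

lemma flag_matroid_eq:
  assumes M: "matroid M" and \<C>: "chain\<^sub>\<subseteq> \<C>"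
  shows "flag_matroid M \<C> = chain_matroid M \<C>"
proof -
  let ?S = "convex_cone hull (indicator_vec ` \<C>)"
  have init: "initial M w = chain_matroid M \<C>" if w: "w \<in> rel_interior ?S" for w
  proof -
    obtain c where c: "w = flag_vec \<C> c" "\<And>F. 0 < c F"
      by (rule rel_interior_convex_cone_hull_indicator[OF w]) blast
    show ?thesis
      unfolding c(1) using M \<C> c(2) by (rule initial_flag_vec)
  qed
  have "convex ?S" "?S \<noteq> {}"
    using convex_cone_convex_cone_hull unfolding convex_cone_def by blast+
  then obtain w where "w \<in> rel_interior ?S"
    using rel_interior_eq_empty by blast
  then show ?thesis
    unfolding flag_matroid_def using init by (intro the_equality) auto
qed

section \<open>Infinite sums of formal power series\<close>

text \<open>Convergence in this topology means that each coefficient is eventually constant;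
  \<open>T n\<close> collects the indices that can affect coefficient \<open>n\<close>.\<close>

lemma has_sum_fpsI:
  fixes f :: "'a \<Rightarrow> 'b::ab_group_add fps"
  assumes "\<And>n. finite (T n)" "\<And>n. T n \<subseteq> A"
    and zero: "\<And>n a. a \<in> A - T n \<Longrightarrow> fps_nth (f a) n = 0"
    and sum: "\<And>n. (\<Sum>a\<in>T n. fps_nth (f a) n) = fps_nth s n"
  shows "(f has_sum s) A"
  unfolding has_sum_def
proof (rule tendsto_fpsI)
  fix n
  have "fps_nth (sum f X) n = fps_nth s n" if X: "finite X" "T n \<subseteq> X" "X \<subseteq> A" for X
  proof -
    have "fps_nth (sum f X) n = (\<Sum>a\<in>X. fps_nth (f a) n)"
      by (rule fps_sum_nth)
    also have "\<dots> = (\<Sum>a\<in>T n. fps_nth (f a) n)"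
      using X zero by (intro sum.mono_neutral_right) auto
    finally show ?thesis using sum by simp
  qed
  then show "\<forall>\<^sub>F X in finite_subsets_at_top A. fps_nth (sum f X) n = fps_nth s n"
    unfolding eventually_finite_subsets_at_top using assms(1,2) by (intro exI[of _ "T n"]) simp
qed

text \<open>Truncation after degree \<open>n\<close> is compatible with multiplication.\<close>

lemma fps_nth_prod_cong:
  fixes f g :: "'a \<Rightarrow> 'b::comm_ring_1 fps"
  assumes "\<And>a k. a \<in> A \<Longrightarrow> k \<le> n \<Longrightarrow> fps_nth (f a) k = fps_nth (g a) k" "k \<le> n"
  shows "fps_nth (prod f A) k = fps_nth (prod g A) k"
  using assms
  by (induction A arbitrary: k rule: infinite_finite_induct) (auto simp: fps_mult_nth)

lemma fps_geometric_nth: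
  fixes x :: "'b::field fps"
  assumes x: "fps_nth x 0 = 0" and "k \<le> n"
  shows "fps_nth (x / (1 - x)) k = fps_nth (\<Sum>i=1..n. x ^ i) k"
proof -
  define y where "y = x / (1 - x)"
  have y: "y * (1 - x) = x"
    unfolding y_def using x by (simp add: fps_divide_unit mult.assoc inverse_mult_eq_1)
  have "y = (\<Sum>i=1..n. x ^ i) + x ^ n * y"
  proof (induction n)
    case (Suc n)
    have "y = x + x * y" using y by (simp add: algebra_simps)
    then have "x ^ n * y = x ^ Suc n + x ^ Suc n * y"
      by (metis distrib_left mult.assoc power_Suc2)
    with Suc show ?case by (simp add: add.assoc)
  qed simp
  moreover have "fps_nth (x ^ n * y) k = 0"
  proof -
    have y0: "fps_nth y 0 = 0"
      unfolding y_def using x by (simp add: fps_divide_unit)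
    have "fps_nth (x ^ n) i = 0" if "i < n" for i
      using that x by (simp add: startsby_zero_power_prefix)
    \<comment> \<open>The boundary case: only \<open>i = k = n\<close> could contribute, and there
      the other factor is the constant term of \<open>y\<close>, which is 0.\<close>
    moreover have "n = i \<and> k = i" if "\<not> i < n" "i \<le> k" for i
      using that \<open>k \<le> n\<close> by simp
    ultimately have "fps_nth (x ^ n) i * fps_nth y (k - i) = 0" if "i \<in> {0..k}" for i
      using that y0 by (cases "i < n") auto
    then show ?thesis
      unfolding fps_mult_nth by (rule sum.neutral[OF ballI])
  qed
  ultimately show ?thesis
    unfolding y_def[symmetric] using fps_add_nth[of "\<Sum>i=1..n. x ^ i" "x ^ n * y" k] by simp
qed

lemma fps_nth_prod_power_eq_0:
  fixes x :: "'a \<Rightarrow> 'b::field fps"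
  assumes "finite A" "\<And>a. a \<in> A \<Longrightarrow> fps_nth (x a) 0 = 0" "a \<in> A" "n < c a"
  shows "fps_nth (\<Prod>a\<in>A. x a ^ c a) n = 0"
proof -
  have "fps_nth (x a ^ c a) i = 0" if "i \<le> n" for i
    using that assms by (simp add: startsby_zero_power_prefix)
  then show ?thesis
    using assms by (simp add: prod.remove[of A a] fps_mult_nth)
qed

text \<open>An exponent above \<open>n\<close> cannot affect coefficient \<open>n\<close>, so
  exponents in \<open>{1..n}\<close> suffice. The product of the truncated geometric series then
  expands into a sum over exponent families by distributivity.\<close>

lemma has_sum_geometric_families:
  fixes x :: "'a \<Rightarrow> 'b::field fps"
  assumes "finite \<A>" "\<And>A. A \<in> \<A> \<Longrightarrow> finite A" "\<And>A a. A \<in> \<A> \<Longrightarrow> a \<in> A \<Longrightarrow> fps_nth (x a) 0 = 0"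
  shows "((\<lambda>(A, c). h A * (\<Prod>a\<in>A. x a ^ c a)) has_sum
            (\<Sum>A\<in>\<A>. h A * (\<Prod>a\<in>A. x a / (1 - x a)))) (SIGMA A:\<A>. PiE A (\<lambda>_. {1..}))"
proof (rule has_sum_fpsI[where T = "\<lambda>n. SIGMA A:\<A>. PiE A (\<lambda>_. {1..n})"])
  fix n :: nat
  show "finite (SIGMA A:\<A>. PiE A (\<lambda>_. {1..n}))"
    using assms by (intro finite_SigmaI finite_PiE) auto
  show "(SIGMA A:\<A>. PiE A (\<lambda>_. {1..n})) \<subseteq> (SIGMA A:\<A>. PiE A (\<lambda>_. {1..}))"
    by (intro Sigma_mono PiE_mono) auto
  show "fps_nth ((\<lambda>(A, c). h A * (\<Prod>a\<in>A. x a ^ c a)) z) n = 0"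
    if "z \<in> (SIGMA A:\<A>. PiE A (\<lambda>_. {1..})) - (SIGMA A:\<A>. PiE A (\<lambda>_. {1..n}))" for z
  proof -
    obtain A c where z: "z = (A, c)" by force
    with that have A: "A \<in> \<A>" and c: "c \<in> PiE A (\<lambda>_. {1..})" "c \<notin> PiE A (\<lambda>_. {1..n})"
      by auto
    then obtain a where a: "a \<in> A" "n < c a"
      by (auto simp: PiE_iff not_le)
    \<comment> \<open>All degrees up to \<open>n\<close> are needed, because \<open>h A\<close> is a
      power series and mixes them.\<close>
    have "fps_nth (\<Prod>a\<in>A. x a ^ c a) i = 0" if "i \<le> n" for i
      using a that assms A by (intro fps_nth_prod_power_eq_0[of A x a]) auto
    then show ?thesis unfolding z by (simp add: fps_mult_nth)
  qed
  have *: "fps_nth (h A * (\<Prod>a\<in>A. x a / (1 - x a))) n =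
      (\<Sum>c\<in>PiE A (\<lambda>_. {1..n}). fps_nth (h A * (\<Prod>a\<in>A. x a ^ c a)) n)" if A: "A \<in> \<A>" for A
  proof -
    have eq: "fps_nth (\<Prod>a\<in>A. x a / (1 - x a)) k = fps_nth (\<Sum>c\<in>PiE A (\<lambda>_. {1..n}). \<Prod>a\<in>A. x a ^ c a) k"
      if "k \<le> n" for k
    proof -
      have "fps_nth (\<Prod>a\<in>A. x a / (1 - x a)) k = fps_nth (\<Prod>a\<in>A. \<Sum>i=1..n. x a ^ i) k"
        by (rule fps_nth_prod_cong[OF _ that]) (rule fps_geometric_nth[OF assms(3)[OF A]])
      also have "(\<Prod>a\<in>A. \<Sum>i=1..n. x a ^ i) = (\<Sum>c\<in>PiE A (\<lambda>_. {1..n}). \<Prod>a\<in>A. x a ^ c a)"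
        using assms A by (intro prod_sum_PiE) auto
      finally show ?thesis .
    qed
    have "fps_nth (h A * (\<Prod>a\<in>A. x a / (1 - x a))) n = fps_nth (h A * (\<Sum>c\<in>PiE A (\<lambda>_. {1..n}). \<Prod>a\<in>A. x a ^ c a)) n"
      unfolding fps_mult_nth by (intro sum.cong refl) (simp add: eq)
    then show ?thesis by (simp add: sum_distrib_left fps_sum_nth)
  qed
  have "(\<Sum>z\<in>(SIGMA A:\<A>. PiE A (\<lambda>_. {1..n})). fps_nth ((\<lambda>(A, c). h A * (\<Prod>a\<in>A. x a ^ c a)) z) n) =
      (\<Sum>(A, c)\<in>(SIGMA A:\<A>. PiE A (\<lambda>_. {1..n})). fps_nth (h A * (\<Prod>a\<in>A. x a ^ c a)) n)"
    by (simp add: split_beta)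
  also have "\<dots> = (\<Sum>A\<in>\<A>. \<Sum>c\<in>PiE A (\<lambda>_. {1..n}). fps_nth (h A * (\<Prod>a\<in>A. x a ^ c a)) n)"
    using assms(1,2) by (intro sum.Sigma[symmetric] ballI finite_PiE) auto
  also have "\<dots> = fps_nth (\<Sum>A\<in>\<A>. h A * (\<Prod>a\<in>A. x a / (1 - x a))) n"
    unfolding fps_sum_nth by (intro sum.cong refl *[symmetric])
  finally show "(\<Sum>z\<in>(SIGMA A:\<A>. PiE A (\<lambda>_. {1..n})). fps_nth ((\<lambda>(A, c). h A * (\<Prod>a\<in>A. x a ^ c a)) z) n) =
      fps_nth (\<Sum>A\<in>\<A>. h A * (\<Prod>a\<in>A. x a / (1 - x a))) n" .
qed

section \<open>The zeta functions\<close>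

lemma q_nonzero: "q \<noteq> 0"
  by (simp add: q_def)

lemma q_minus_1_nonzero: "q - 1 \<noteq> 0"
proof -
  have "q - 1 = to_fract ([:0, 1:] - 1)"
    by (simp add: q_def)
  also have "\<dots> \<noteq> 0"
    unfolding to_fract_eq_0_iff by (simp add: one_pCons)
  finally show ?thesis .
qed

lemma q_powi_diff: "q powi (a - b) = q powi a * q powi (- b)"
  using power_int_add[of q a "- b"] q_nonzero by simp

text \<open>For a matroid, a chain and positive \<open>c\<close>, the two sums are the maximal
  weight and the coordinate sum of \<open>flag_vec \<C> c\<close>, so this is the monomial that the
  vector contributes.\<close>

lemma flat_monomial_power_prod:
  assumes "finite \<C>"
  shows "(\<Prod>F\<in>\<C>. flat_monomial M F ^ c F) =
    fps_const (q powi (- (\<Sum>F\<in>\<C>. int (c F) * int (rk M F)))) * fps_X ^ (\<Sum>F\<in>\<C>. c F * card F)"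
  using assms
proof (induction \<C> rule: finite_induct)
  case (insert F \<C>)
  have "q powi (- (int (c F) * int (rk M F))) = (q powi (- int (rk M F))) ^ c F"
    by (simp add: power_int_mult[symmetric] mult.commute flip: power_int_of_nat)
  then have "flat_monomial M F ^ c F = fps_const (q powi (- (int (c F) * int (rk M F)))) * fps_X ^ (c F * card F)"
    by (simp add: flat_monomial_def power_mult_distrib fps_const_power mult.commute flip: power_mult)
  then have "(\<Prod>G\<in>insert F \<C>. flat_monomial M G ^ c G) =
      fps_const (q powi (- (int (c F) * int (rk M F))) * q powi (- (\<Sum>G\<in>\<C>. int (c G) * int (rk M G)))) *
      fps_X ^ (c F * card F + (\<Sum>G\<in>\<C>. c G * card G))"
    by (simp only: prod.insert[OF insert.hyps] insert.IH power_add fps_const_mult[symmetric] mult_ac)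
  also have "q powi (- (int (c F) * int (rk M F))) * q powi (- (\<Sum>G\<in>\<C>. int (c G) * int (rk M G))) =
      q powi (- (\<Sum>G\<in>insert F \<C>. int (c G) * int (rk M G)))"
    using insert.hyps q_powi_diff[symmetric] by simp
  finally show ?case
    using insert.hyps by simp
qed simp

lemma flags_subset_chain_families: "flags M \<subseteq> chain_families"
  by (auto simp: flags_def chain_families_def)

text \<open>The product supplies one factor \<open>q - 1\<close> per member, which cancels the
  denominator; the sums are computed without these factors, which are put back at the end.\<close>

lemma flag_cancel_q_minus_1:
  assumes "finite \<C>"
  shows "fps_const (r / (q - 1) ^ card \<C>) * (\<Prod>F\<in>\<C>. fps_const (q - 1) * g F) = fps_const r * (\<Prod>F\<in>\<C>. g F)"
proof -
  have "fps_const (r / (q - 1) ^ card \<C>) * fps_const ((q - 1) ^ card \<C>) = fps_const r"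
    using q_minus_1_nonzero by simp
  then show ?thesis
    by (simp add: prod.distrib fps_const_power flip: mult.assoc)
qed

text \<open>
  The predicate \<open>P\<close> will be constantly true, the identity or negation for the three zeta functions.
\<close>

lemma infsum_initial:
  fixes M :: "'e::finite set set" and p :: "'e set set \<Rightarrow> int poly"
  assumes M: "matroid M" and p: "\<And>N. charpoly N = 0 \<Longrightarrow> p N = 0"
  shows "(\<Sum>\<^sub>\<infinity>w\<in>{w. (\<forall>e. 0 \<le> vec_nth w e) \<and> P (\<forall>e. 0 < vec_nth w e)}.
            fps_const (to_fract (p (initial M w)) * q powi (- k - wt M w)) * fps_X ^ nat (coord_sum w)) =
         fps_const (q powi (- k)) *
           (\<Sum>\<F>\<in>{\<F> \<in> flags M. P (UNIV \<in> \<F>)}.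
              fps_const (to_fract (p (flag_matroid M \<F>)) / (q - 1) ^ card \<F>) *
              (\<Prod>F\<in>\<F>. fps_const (q - 1) * (flat_monomial M F / (1 - flat_monomial M F))))"
    (is "infsum ?t ?W = ?R")
proof -
  \<comment> \<open>All chains of nonempty sets occur at first, as decomposing a vector does not see
    the flats.\<close>
  let ?A = "{\<C> \<in> chain_families. P (UNIV \<in> \<C>)}"
  let ?h = "\<lambda>\<C>. fps_const (to_fract (p (chain_matroid M \<C>)) * q powi (- k))"
  let ?f = "\<lambda>(\<C>, c). flag_vec \<C> (\<lambda>F. int (c F))"
  let ?S = "SIGMA \<C>:?A. PiE \<C> (\<lambda>_. {1..})"
  let ?x = "\<lambda>F. flat_monomial M F / (1 - flat_monomial M F)"
  have summand: "?t (?f z) = (\<lambda>(\<C>, c). ?h \<C> * (\<Prod>F\<in>\<C>. flat_monomial M F ^ c F)) z" if z: "z \<in> ?S" for z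
  proof -
    obtain \<C> c where zc: "z = (\<C>, c)" by force
    with z have C: "chain\<^sub>\<subseteq> \<C>" and c: "\<And>F. F \<in> \<C> \<Longrightarrow> 0 < int (c F)"
      by (auto simp: chain_families_def PiE_iff Suc_le_eq)
    let ?w = "flag_vec \<C> (\<lambda>F. int (c F))"
    have "initial M ?w = chain_matroid M \<C>"
      using M C c by (rule initial_flag_vec)
    moreover have "wt M ?w = (\<Sum>F\<in>\<C>. int (c F) * int (rk M F))"
      using M C c by (rule wt_flag_vec)
    moreover have "coord_sum ?w = int (\<Sum>F\<in>\<C>. c F * card F)"
      unfolding coord_sum_def sum_flag_vec by simp
    ultimately have "?t ?w = fps_const (to_fract (p (chain_matroid M \<C>)) * (q powi (- k) *
        q powi (- (\<Sum>F\<in>\<C>. int (c F) * int (rk M F))))) * fps_X ^ (\<Sum>F\<in>\<C>. c F * card F)"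
      by (simp only: q_powi_diff nat_int)
    then show ?thesis
      unfolding zc prod.case flat_monomial_power_prod[OF finite]
      by (simp only: fps_const_mult[symmetric] mult.assoc)
  qed
  have "infsum ?t ?W = infsum (\<lambda>z. ?t (?f z)) ?S"
    by (rule infsum_reindex_bij_betw[OF flag_vec_bij_betw, symmetric])
  also have "\<dots> = infsum (\<lambda>(\<C>, c). ?h \<C> * (\<Prod>F\<in>\<C>. flat_monomial M F ^ c F)) ?S"
    by (rule infsum_cong) (rule summand)
  also have "\<dots> = (\<Sum>\<C>\<in>?A. ?h \<C> * (\<Prod>F\<in>\<C>. ?x F))"
  proof (rule infsumI, rule has_sum_geometric_families)
    show "fps_nth (flat_monomial M F) 0 = 0" if "\<C> \<in> ?A" "F \<in> \<C>" for \<C> F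
    proof -
      have "F \<noteq> {}" using that by (auto simp: chain_families_def)
      then have "card F \<noteq> 0" by simp
      then show ?thesis by (simp add: flat_monomial_def)
    qed
  qed simp_all
  \<comment> \<open>Chains that are not flags drop out: their initial matroid has a vanishing
    characteristic polynomial, hence \<open>p\<close> vanishes on it.\<close>
  also have "\<dots> = (\<Sum>\<C>\<in>{\<F> \<in> flags M. P (UNIV \<in> \<F>)}. ?h \<C> * (\<Prod>F\<in>\<C>. ?x F))"
  proof (rule sum.mono_neutral_right)
    show "\<forall>\<C>\<in>?A - {\<F> \<in> flags M. P (UNIV \<in> \<F>)}. ?h \<C> * (\<Prod>F\<in>\<C>. ?x F) = 0"
    proof
      fix \<C> assume "\<C> \<in> ?A - {\<F> \<in> flags M. P (UNIV \<in> \<F>)}"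
      then have "p (chain_matroid M \<C>) = 0"
        by (intro p charpoly_chain_matroid_eq_0[OF M]) (auto simp: chain_families_def)
      then show "?h \<C> * (\<Prod>F\<in>\<C>. ?x F) = 0" by simp
    qed
  qed (use flags_subset_chain_families in auto)
  also have "\<dots> = ?R"
    unfolding sum_distrib_left
  proof (intro sum.cong refl)
    fix \<F> assume "\<F> \<in> {\<F> \<in> flags M. P (UNIV \<in> \<F>)}"
    then have "flag_matroid M \<F> = chain_matroid M \<F>"
      using flag_matroid_eq[OF M] by (simp add: flags_def)
    then show "?h \<F> * (\<Prod>F\<in>\<F>. ?x F) = fps_const (q powi (- k)) *
        (fps_const (to_fract (p (flag_matroid M \<F>)) / (q - 1) ^ card \<F>) * (\<Prod>F\<in>\<F>. fps_const (q - 1) * ?x F))"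
      by (subst flag_cancel_q_minus_1) (simp_all add: mult_ac flip: fps_const_mult)
  qed
  finally show ?thesis .
qed

section \<open>Vectors modulo the all-ones line\<close>

text \<open>All bases have the same cardinality, so adding a constant shifts all their weights
  equally.\<close>

lemma wt_add_const:
  fixes w :: "'b::linordered_idom ^ 'e::finite"
  assumes M: "matroid M"
  shows "wt M (w + (\<chi> e. c)) = wt M w + of_nat (rk M UNIV) * c"
    and "initial M (w + (\<chi> e. c)) = initial M w"
proof -
  have sum: "(\<Sum>e\<in>B. vec_nth (w + (\<chi> e. c)) e) = (\<Sum>e\<in>B. vec_nth w e) + of_nat (rk M UNIV) * c" if "B \<in> M" for B
    using basis_card[OF M that] by (simp add: sum.distrib)
  have ne: "M \<noteq> {}" using M by (simp add: matroid_def)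
  have "wt M (w + (\<chi> e. c)) = Max ((\<lambda>B. (\<Sum>e\<in>B. vec_nth w e) + of_nat (rk M UNIV) * c) ` M)"
    unfolding wt_def using sum by (intro arg_cong[of _ _ Max] image_cong refl)
  also have "\<dots> = wt M w + of_nat (rk M UNIV) * c"
    unfolding wt_def using ne by (intro Max_add_commute) simp
  finally show wt: "wt M (w + (\<chi> e. c)) = wt M w + of_nat (rk M UNIV) * c" .
  show "initial M (w + (\<chi> e. c)) = initial M w"
    unfolding initial_def wt using sum by auto
qed

lemma min_entry_add_const: "min_entry (w + (\<chi> e. c)) = min_entry w + c"
  unfolding min_entry_def vector_add_component vec_lambda_beta by (rule Min_add_commute) simp_all

lemma coord_sum_add_const:
  fixes w :: "'b::linordered_idom ^ 'e::finite"
  shows "coord_sum (w + (\<chi> e. c)) = coord_sum w + of_nat CARD('e) * c"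
  by (simp add: coord_sum_def sum.distrib)

text \<open>The right-hand side is the index condition of \<open>infsum_initial\<close> with
  negation as \<open>P\<close>.\<close>

lemma min_entry_eq_0_iff: "min_entry w = 0 \<longleftrightarrow> (\<forall>e. 0 \<le> vec_nth w e) \<and> \<not> (\<forall>e. 0 < vec_nth w e)"
proof -
  have "min_entry w = 0 \<longleftrightarrow> 0 \<in> range (vec_nth w) \<and> (\<forall>x\<in>range (vec_nth w). 0 \<le> x)"
    unfolding min_entry_def by (rule Min_eq_iff) auto
  also have "\<dots> \<longleftrightarrow> (\<exists>e. vec_nth w e = 0) \<and> (\<forall>e. 0 \<le> vec_nth w e)"
    by (simp add: image_iff eq_commute[of 0])
  also have "\<dots> \<longleftrightarrow> (\<forall>e. 0 \<le> vec_nth w e) \<and> \<not> (\<forall>e. 0 < vec_nth w e)"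
  proof -
    have "vec_nth w e = 0 \<longleftrightarrow> \<not> 0 < vec_nth w e" if "\<forall>e. 0 \<le> vec_nth w e" for e
      using that[rule_format, of e] by auto
    then show ?thesis by blast
  qed
  finally show ?thesis .
qed

lemma lift_ones_rel:
  obtains c where "lift (ones_rel `` {w}) = w + (\<chi> e. c)"
proof -
  have "w = w + (\<chi> e. 0)" by (simp add: vec_eq_iff)
  then have "w \<in> ones_rel `` {w}"
    unfolding ones_rel_def by blast
  then have "lift (ones_rel `` {w}) \<in> ones_rel `` {w}"
    unfolding lift_def by (rule someI)
  then show thesis using that unfolding ones_rel_def by blast
qed

text \<open>Adding a constant to a vector adds it to the minimum, so each coset has exactly one
  representative with minimum 0.\<close>

lemma ones_rel_bij_betw:
  "bij_betw (\<lambda>w. ones_rel `` {w}) {w :: 'b::linordered_idom ^ 'e::finite. min_entry w = 0} (UNIV // ones_rel)"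
proof -
  have sub: "ones_rel `` {w + (\<chi> e. c)} \<subseteq> ones_rel `` {w}" for w :: "'b ^ 'e" and c
  proof
    fix x assume "x \<in> ones_rel `` {w + (\<chi> e. c)}"
    then obtain d where "x = w + (\<chi> e. c) + (\<chi> e. d)" unfolding ones_rel_def by blast
    then have "x = w + (\<chi> e. c + d)" by (simp add: vec_eq_iff add.assoc)
    then show "x \<in> ones_rel `` {w}" unfolding ones_rel_def by blast
  qed
  have shift: "ones_rel `` {w + (\<chi> e. c)} = ones_rel `` {w}" for w :: "'b ^ 'e" and c
  proof (rule equalityI[OF sub])
    have "w + (\<chi> e. c) + (\<chi> e. - c) = w" by (simp add: vec_eq_iff)
    then show "ones_rel `` {w} \<subseteq> ones_rel `` {w + (\<chi> e. c)}"
      using sub[of "w + (\<chi> e. c)" "- c"] by (simp only:)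
  qed
  show ?thesis
    unfolding bij_betw_def
  proof (intro conjI inj_onI equalityI subsetI)
    fix w w' :: "'b ^ 'e"
    assume w: "w \<in> {w. min_entry w = 0}" "w' \<in> {w. min_entry w = 0}" "ones_rel `` {w} = ones_rel `` {w'}"
    have "w + (\<chi> e. 0) \<in> ones_rel `` {w}" unfolding ones_rel_def by blast
    moreover have "w + (\<chi> e. 0) = w" by (simp add: vec_eq_iff)
    ultimately have "w \<in> ones_rel `` {w'}" using w(3) by simp
    then obtain c where c: "w = w' + (\<chi> e. c)" unfolding ones_rel_def by blast
    with w have "c = 0" by (simp add: min_entry_add_const)
    then show "w = w'" using c by (simp add: vec_eq_iff)
  next
    fix v :: "('b ^ 'e) set" assume "v \<in> (\<lambda>w. ones_rel `` {w}) ` {w. min_entry w = 0}"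
    then show "v \<in> UNIV // ones_rel" by (auto intro: quotientI)
  next
    fix v :: "('b ^ 'e) set" assume "v \<in> UNIV // ones_rel"
    then obtain w where v: "v = ones_rel `` {w}" by (auto elim: quotientE)
    have "min_entry (w + (\<chi> e. - min_entry w)) = 0"
      by (simp only: min_entry_add_const add.right_inverse)
    then show "v \<in> (\<lambda>w. ones_rel `` {w}) ` {w. min_entry w = 0}"
      unfolding v by (intro image_eqI[of _ _ "w + (\<chi> e. - min_entry w)"]) (simp_all add: shift)
  qed
qed

text \<open>The lift chosen may differ from \<open>w\<close> by a constant \<open>c\<close>, but the
  minimum then equals \<open>c\<close>, and subtracting its multiple undoes the shift.\<close>

lemma bar_ones_rel:
  assumes M: "matroid M" and w: "min_entry w = 0"
  shows "initial_bar M (ones_rel `` {w}) = initial M w" "wt_bar M (ones_rel `` {w}) = wt M w"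
    "coord_sum_bar (ones_rel `` {w}) = coord_sum w"
proof -
  obtain c where c: "lift (ones_rel `` {w}) = w + (\<chi> e. c)" by (rule lift_ones_rel)
  show "initial_bar M (ones_rel `` {w}) = initial M w" "wt_bar M (ones_rel `` {w}) = wt M w"
    "coord_sum_bar (ones_rel `` {w}) = coord_sum w"
    unfolding initial_bar_def wt_bar_def coord_sum_bar_def c wt_add_const[OF M] min_entry_add_const
      coord_sum_add_const w by simp_all
qed

theorem theorem3p1:
  fixes M :: "'e::finite set set"
  assumes "matroid M"
  shows "zeta M =
           fps_const (q powi (- int (rk M UNIV))) *
           (\<Sum>\<F>\<in>flags M.
              fps_const (to_fract (charpoly (flag_matroid M \<F>)) / (q - 1) ^ card \<F>) *
              (\<Prod>F\<in>\<F>. fps_const (q - 1) * (flat_monomial M F / (1 - flat_monomial M F)))) \<and>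
         zeta0 M =
           fps_const (q powi (- int (rk M UNIV))) *
           (\<Sum>\<F>\<in>flags_star M.
              fps_const (to_fract (charpoly (flag_matroid M \<F>)) / (q - 1) ^ card \<F>) *
              (\<Prod>F\<in>\<F>. fps_const (q - 1) * (flat_monomial M F / (1 - flat_monomial M F)))) \<and>
         zeta_bar M =
           fps_const (q powi (- (int (rk M UNIV) - 1))) *
           (\<Sum>\<F>\<in>flags_circ M.
              fps_const (to_fract (reduced_charpoly (flag_matroid M \<F>)) / (q - 1) ^ card \<F>) *
              (\<Prod>F\<in>\<F>. fps_const (q - 1) * (flat_monomial M F / (1 - flat_monomial M F))))"
proof (intro conjI)
  note main = infsum_initial[OF assms, where p = charpoly and k = "int (rk M UNIV)", folded zeta_term_def]
  show "zeta M =
           fps_const (q powi (- int (rk M UNIV))) *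
           (\<Sum>\<F>\<in>flags M.
              fps_const (to_fract (charpoly (flag_matroid M \<F>)) / (q - 1) ^ card \<F>) *
              (\<Prod>F\<in>\<F>. fps_const (q - 1) * (flat_monomial M F / (1 - flat_monomial M F))))"
    using main[where P = "\<lambda>_. True"] by (simp add: zeta_def)
  \<comment> \<open>Brings the index set into the shape required for the identity as
    \<open>P\<close>.\<close>
  have "{w :: int ^ 'e. \<forall>e. 0 < vec_nth w e} = {w. (\<forall>e. 0 \<le> vec_nth w e) \<and> (\<forall>e. 0 < vec_nth w e)}"
    by (auto intro: less_imp_le)
  then show "zeta0 M =
           fps_const (q powi (- int (rk M UNIV))) *
           (\<Sum>\<F>\<in>flags_star M.
              fps_const (to_fract (charpoly (flag_matroid M \<F>)) / (q - 1) ^ card \<F>) *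
              (\<Prod>F\<in>\<F>. fps_const (q - 1) * (flat_monomial M F / (1 - flat_monomial M F))))"
    using main[where P = "\<lambda>b. b"] by (simp add: zeta0_def flags_star_def)
  let ?t = "\<lambda>v :: (int ^ 'e) set. fps_const (to_fract (reduced_charpoly (initial_bar M v))
                     * q powi (- (int (rk M UNIV) - 1) - wt_bar M v)) * fps_X ^ nat (coord_sum_bar v)"
  let ?W = "{w :: int ^ 'e. (\<forall>e. 0 \<le> vec_nth w e) \<and> \<not> (\<forall>e. 0 < vec_nth w e)}"
  \<comment> \<open>Cosets are replaced by their representatives with minimum 0: nonnegative vectors
    that are not positive, whose chains omit the whole ground set.\<close>
  have "bij_betw (\<lambda>w. ones_rel `` {w}) ?W (UNIV // ones_rel)"
    using ones_rel_bij_betw unfolding min_entry_eq_0_iff .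
  then have "zeta_bar M = infsum (\<lambda>w. ?t (ones_rel `` {w})) ?W"
    unfolding zeta_bar_def by (rule infsum_reindex_bij_betw[symmetric])
  also have "\<dots> = infsum (\<lambda>w. fps_const (to_fract (reduced_charpoly (initial M w))
                     * q powi (- (int (rk M UNIV) - 1) - wt M w)) * fps_X ^ nat (coord_sum w)) ?W"
  proof (rule infsum_cong)
    fix w assume "w \<in> ?W"
    then have "min_entry w = 0" by (simp add: min_entry_eq_0_iff)
    then show "?t (ones_rel `` {w}) = fps_const (to_fract (reduced_charpoly (initial M w))
                     * q powi (- (int (rk M UNIV) - 1) - wt M w)) * fps_X ^ nat (coord_sum w)"
      by (simp only: bar_ones_rel[OF assms])
  qed
  also have "\<dots> = fps_const (q powi (- (int (rk M UNIV) - 1))) *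
           (\<Sum>\<F>\<in>{\<F> \<in> flags M. UNIV \<notin> \<F>}.
              fps_const (to_fract (reduced_charpoly (flag_matroid M \<F>)) / (q - 1) ^ card \<F>) *
              (\<Prod>F\<in>\<F>. fps_const (q - 1) * (flat_monomial M F / (1 - flat_monomial M F))))"
    \<comment> \<open>Here \<open>p\<close> is \<open>reduced_charpoly\<close>, which vanishes along
      with \<open>charpoly\<close> because 0 divided by a polynomial is 0.\<close>
    by (rule infsum_initial[OF assms]) (simp add: reduced_charpoly_def)
  also have "{\<F> \<in> flags M. UNIV \<notin> \<F>} = flags_circ M"
    unfolding flags_circ_def flags_star_def by blast
  finally show "zeta_bar M =
           fps_const (q powi (- (int (rk M UNIV) - 1))) *
           (\<Sum>\<F>\<in>flags_circ M.
              fps_const (to_fract (reduced_charpoly (flag_matroid M \<F>)) / (q - 1) ^ card \<F>) *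
              (\<Prod>F\<in>\<F>. fps_const (q - 1) * (flat_monomial M F / (1 - flat_monomial M F))))" .
qed

end
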